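(* Let $\alpha\in(0,1)$. In the setting described in the context, let $\delta_1,\dots,\delta_N\in\{0,1\}$ be the decisions produced by the oracle Ranking by Lifts (RBL) procedure at level $\alpha$. Then the procedure controls the cost-weighted false discovery rate at level $\alpha$: $$\mathbb{E}\left[\frac{\sum_{i=1}^N (1-\theta_i)\,\delta_i\,c_i}{\sum_{i=1}^N \delta_i\,c_i}\right]\le\alpha ,$$ where the ratio is taken to be $0$ when its denominator is $0$.
   Context: Setting. There are $N$ experiments. Experiment $i$ has a baseline ("champion") conversion rate $p_{i0}$ and a "challenger" conversion rate $p_{i1}$, both random in a Bayesian (empirical Bayes) model, lift $\ell_i=p_{i1}/p_{i0}-1$, and indicator $\theta_i=\mathbf{1}\{\ell_i>0\}$. Known constants are the switching cost $c_i>0$ and the baseline profit $\Pi_i>0$. Data are observed, and a decision $\delta_i\in\{0,1\}$ ($1$ = reject the null / switch to the challenger) is a measurable function of the data. The oracle knows the model, hence the following posterior quantities: $\mathrm{lfdr}_i=\Pr(\theta_i=0\mid \mathrm{data})$; the weight $W_i=\mathbb{E}[c_i(1-\theta_i-\alpha)\mid \mathrm{data}]=c_i(\mathrm{lfdr}_i-\alpha)$; and the value $V_i=\mathbb{E}[\Pi_i\ell_i\mid \mathrm{data}]$ (assumed to exist and be finite). Oracle RBL procedure at level $\alpha$. 1. Baseline decisions: $\delta_i^b=1$ if $W_i<0$, or if $W_i=0$ and $V_i>0$; otherwise $\delta_i^b=0$. The total capacity is $C_T=\sum_{i:\,\mathrm{lfdr}_i<\alpha}c_i(\alpha-\mathrm{lfdr}_i)$.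 2. The consideration set consists of all $i$ with $W_iV_i>0$ (weight and value both positive or both negative). Rank its elements in decreasing order of the ratio $V_i/W_i>0$, ties broken by a fixed rule, and write $(1),(2),\dots$ for the ranked elements. 3. Let $C(j)=\sum_{r=1}^{j}|W_{(r)}|$, $C(0)=0$, and let $k$ be the largest $j\ge 0$ (not exceeding the size of the consideration set) with $C(j)\le C_T$. 4. Final decisions: $\delta_i=1-\delta_i^b$ if $i\in\{(1),\dots,(k)\}$, and $\delta_i=\delta_i^b$ for all other $i$. *)

theory Defs
  imports "HOL-Probability.Probability"
begin

subsection \<open>The Bayesian model\<close>

definition lift :: "('a \<Rightarrow> real) \<Rightarrow> ('a \<Rightarrow> real) \<Rightarrow> 'a \<Rightarrow> real" where
  "lift p0 p1 \<omega> = p1 \<omega> / p0 \<omega> - 1"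

definition theta :: "('a \<Rightarrow> real) \<Rightarrow> ('a \<Rightarrow> real) \<Rightarrow> 'a \<Rightarrow> real" where
  "theta p0 p1 \<omega> = (if lift p0 p1 \<omega> > 0 then 1 else 0)"

text \<open>The data are a random element \<open>X\<close> of a measurable space \<open>D\<close>; posterior quantities are
  conditional expectations given the \<open>\<sigma>\<close>-algebra on \<open>space M\<close> generated by \<open>X\<close>.\<close>

abbreviation data_algebra :: "'a measure \<Rightarrow> 'd measure \<Rightarrow> ('a \<Rightarrow> 'd) \<Rightarrow> 'a measure" where
  "data_algebra M D X \<equiv> vimage_algebra (space M) X D"

definition lfdr ::
  "'a measure \<Rightarrow> 'd measure \<Rightarrow> ('a \<Rightarrow> 'd) \<Rightarrow> ('a \<Rightarrow> real) \<Rightarrow> ('a \<Rightarrow> real) \<Rightarrow> 'a \<Rightarrow> real" where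
  "lfdr M D X p0 p1 =
     real_cond_exp M (data_algebra M D X) (indicator {\<omega>. theta p0 p1 \<omega> = 0})"

definition weight ::
  "'a measure \<Rightarrow> 'd measure \<Rightarrow> ('a \<Rightarrow> 'd) \<Rightarrow> real \<Rightarrow> real \<Rightarrow> ('a \<Rightarrow> real) \<Rightarrow> ('a \<Rightarrow> real)
     \<Rightarrow> 'a \<Rightarrow> real" where
  "weight M D X \<alpha> c p0 p1 =
     real_cond_exp M (data_algebra M D X) (\<lambda>\<omega>. c * (1 - theta p0 p1 \<omega> - \<alpha>))"

definition post_value ::
  "'a measure \<Rightarrow> 'd measure \<Rightarrow> ('a \<Rightarrow> 'd) \<Rightarrow> real \<Rightarrow> ('a \<Rightarrow> real) \<Rightarrow> ('a \<Rightarrow> real)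
     \<Rightarrow> 'a \<Rightarrow> real" where
  "post_value M D X profit p0 p1 =
     real_cond_exp M (data_algebra M D X) (\<lambda>\<omega>. profit * lift p0 p1 \<omega>)"

text \<open>The conditional expectation of \<open>profit * lift\<close> exists and is finite almost surely.  This is
  implied by integrability of the lift, but does not require it.\<close>

definition post_value_finite ::
  "'a measure \<Rightarrow> 'd measure \<Rightarrow> ('a \<Rightarrow> 'd) \<Rightarrow> real \<Rightarrow> ('a \<Rightarrow> real) \<Rightarrow> ('a \<Rightarrow> real) \<Rightarrow> bool" where
  "post_value_finite M D X profit p0 p1 \<longleftrightarrow>
     (AE \<omega> in M. nn_cond_exp M (data_algebra M D X)
                   (\<lambda>\<omega>. ennreal \<bar>profit * lift p0 p1 \<omega>\<bar>) \<omega> < \<infinity>)"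

subsection \<open>The Ranking by Lifts procedure\<close>

text \<open>The procedure is stated for given numerical costs \<open>c\<close>, local false discovery rates \<open>L\<close>,
  weights \<open>W\<close> and values \<open>V\<close>, all indexed by the experiments \<open>1, \<dots>, N\<close>.\<close>

definition baseline_decision :: "(nat \<Rightarrow> real) \<Rightarrow> (nat \<Rightarrow> real) \<Rightarrow> nat \<Rightarrow> real" where
  "baseline_decision W V i = (if W i < 0 \<or> (W i = 0 \<and> V i > 0) then 1 else 0)"

definition total_capacity :: "nat \<Rightarrow> real \<Rightarrow> (nat \<Rightarrow> real) \<Rightarrow> (nat \<Rightarrow> real) \<Rightarrow> real" where
  "total_capacity N \<alpha> c L = (\<Sum>i\<in>{i\<in>{1..N}. L i < \<alpha>}. c i * (\<alpha> - L i))"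

definition consideration_set :: "nat \<Rightarrow> (nat \<Rightarrow> real) \<Rightarrow> (nat \<Rightarrow> real) \<Rightarrow> nat set" where
  "consideration_set N W V = {i\<in>{1..N}. W i * V i > 0}"

text \<open>Since \<^const>\<open>sort_key\<close> is stable, equal ratios are ordered by increasing priority number
  \<open>prio i\<close>, and experiments that also agree there by their index.\<close>

definition ranking :: "nat \<Rightarrow> (nat \<Rightarrow> nat) \<Rightarrow> (nat \<Rightarrow> real) \<Rightarrow> (nat \<Rightarrow> real) \<Rightarrow> nat list" where
  "ranking N prio W V =
     sort_key (\<lambda>i. - (V i / W i))
       (sort_key prio (sorted_list_of_set (consideration_set N W V)))"

definition cum_weight :: "(nat \<Rightarrow> real) \<Rightarrow> nat list \<Rightarrow> nat \<Rightarrow> real" where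
  "cum_weight W xs j = (\<Sum>r<j. \<bar>W (xs ! r)\<bar>)"

definition num_flips :: "(nat \<Rightarrow> real) \<Rightarrow> real \<Rightarrow> nat list \<Rightarrow> nat" where
  "num_flips W CT xs = Max {j. j \<le> length xs \<and> cum_weight W xs j \<le> CT}"

definition rbl_decision ::
  "nat \<Rightarrow> (nat \<Rightarrow> nat) \<Rightarrow> real \<Rightarrow> (nat \<Rightarrow> real) \<Rightarrow> (nat \<Rightarrow> real) \<Rightarrow> (nat \<Rightarrow> real) \<Rightarrow> (nat \<Rightarrow> real)
     \<Rightarrow> nat \<Rightarrow> real" where
  "rbl_decision N prio \<alpha> c L W V i =
     (let xs = ranking N prio W V;
          k = num_flips W (total_capacity N \<alpha> c L) xs
      in if i \<in> set (take k xs) then 1 - baseline_decision W V i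
         else baseline_decision W V i)"

text \<open>The tie-breaking priorities are a deterministic function of the observed data; a fixed
  order of the experiments is the special case of a constant function.\<close>

definition oracle_rbl ::
  "'a measure \<Rightarrow> 'd measure \<Rightarrow> ('a \<Rightarrow> 'd) \<Rightarrow> nat \<Rightarrow> ('d \<Rightarrow> nat \<Rightarrow> nat) \<Rightarrow> real
     \<Rightarrow> (nat \<Rightarrow> real) \<Rightarrow> (nat \<Rightarrow> real) \<Rightarrow> (nat \<Rightarrow> 'a \<Rightarrow> real) \<Rightarrow> (nat \<Rightarrow> 'a \<Rightarrow> real)
     \<Rightarrow> nat \<Rightarrow> 'a \<Rightarrow> real" where
  "oracle_rbl M D X N prio \<alpha> c profit p0 p1 i \<omega> =
     rbl_decision N (prio (X \<omega>)) \<alpha> c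
       (\<lambda>j. lfdr M D X (p0 j) (p1 j) \<omega>)
       (\<lambda>j. weight M D X \<alpha> (c j) (p0 j) (p1 j) \<omega>)
       (\<lambda>j. post_value M D X (profit j) (p0 j) (p1 j) \<omega>) i"

end

theory Submission
  imports Defs
begin

text \<open>The baseline decisions have total weight \<open>\<Sum>i. \<delta>\<^sup>b i * W i = - C\<^sub>T\<close>, and flipping a decision in
  the consideration set raises this sum by exactly \<open>\<bar>W i\<bar>\<close>, so the capacity constraint keeps the
  final sum nonpositive.  As \<open>W i = c i * (lfdr i - \<alpha>)\<close>, this says that the posterior expectation
  of the cost-weighted false discovery proportion is at most \<open>\<alpha>\<close>.  The decisions are functions of
  the data, so integrating \<open>(1 - \<theta> i) * \<delta> i * c i / (\<Sum>j. \<delta> j * c j)\<close> amounts to replacing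
  \<open>1 - \<theta> i\<close> by \<open>lfdr i\<close>.\<close>

subsection \<open>The capacity constraint\<close>

lemma finite_consideration_set: "finite (consideration_set N W V)"
  by (simp add: consideration_set_def)

lemma set_ranking: "set (ranking N prio W V) = consideration_set N W V"
  by (simp add: ranking_def finite_consideration_set)

lemma distinct_ranking: "distinct (ranking N prio W V)"
  by (simp add: ranking_def)

text \<open>Nonnegative capacity makes \<open>j = 0\<close> feasible, so the maximum is attained
  over a nonempty finite set; on an empty set \<open>Max\<close> would be unspecified.\<close>

lemma num_flips_bounds:
  assumes "0 \<le> CT"
  shows "num_flips W CT xs \<le> length xs" "cum_weight W xs (num_flips W CT xs) \<le> CT"
proof -
  let ?J = "{j. j \<le> length xs \<and> cum_weight W xs j \<le> CT}"
  have "0 \<in> ?J" using assms by (simp add: cum_weight_def)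
  moreover have "finite ?J" by simp
  ultimately have "num_flips W CT xs \<in> ?J"
    unfolding num_flips_def using Max_in[of ?J] by blast
  then show "num_flips W CT xs \<le> length xs" "cum_weight W xs (num_flips W CT xs) \<le> CT"
    by auto
qed

lemma cum_weight_eq_sum:
  assumes "distinct xs" "k \<le> length xs"
  shows "cum_weight W xs k = (\<Sum>i\<in>set (take k xs). \<bar>W i\<bar>)"
proof -
  have "set (take k xs) = (!) xs ` {..<k}"
    using nth_image[OF assms(2)] by (simp add: atLeast0LessThan)
  moreover have "inj_on ((!) xs) {..<k}"
    using assms by (intro inj_on_nth) auto
  ultimately show ?thesis by (simp add: cum_weight_def sum.reindex)
qed

lemma rbl_decision_01: "rbl_decision N prio \<alpha> c L W V i \<in> {0, 1}"
  by (auto simp: rbl_decision_def Let_def baseline_decision_def)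

lemma total_capacity_nonneg:
  assumes "\<And>i. i \<in> {1..N} \<Longrightarrow> c i > 0"
  shows "0 \<le> total_capacity N \<alpha> c L"
  unfolding total_capacity_def using assms by (intro sum_nonneg) (simp add: less_imp_le)

text \<open>A positive cost gives \<open>W i\<close> the sign of \<open>L i - \<alpha>\<close>, so
  the baseline rejections of nonzero weight are exactly the terms of the capacity; those made at
  \<open>W i = 0\<close> add nothing to the sum.\<close>

lemma sum_baseline_weight:
  assumes "\<And>i. i \<in> {1..N} \<Longrightarrow> c i > 0"
    and W: "\<And>i. i \<in> {1..N} \<Longrightarrow> W i = c i * (L i - \<alpha>)"
  shows "(\<Sum>i=1..N. baseline_decision W V i * W i) = - total_capacity N \<alpha> c L"
proof -
  have "total_capacity N \<alpha> c L = (\<Sum>i=1..N. if L i < \<alpha> then c i * (\<alpha> - L i) else 0)"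
    unfolding total_capacity_def by (rule sum.inter_filter) simp
  also have "- \<dots> = (\<Sum>i=1..N. baseline_decision W V i * W i)"
    unfolding sum_negf[symmetric]
  proof (rule sum.cong)
    fix i assume i: "i \<in> {1..N}"
    have "W i < 0 \<longleftrightarrow> L i < \<alpha>"
      using assms(1)[OF i] by (simp add: W[OF i] mult_less_0_iff)
    moreover have "W i = - (c i * (\<alpha> - L i))" by (simp add: W[OF i] algebra_simps)
    ultimately show "- (if L i < \<alpha> then c i * (\<alpha> - L i) else 0) = baseline_decision W V i * W i"
      by (simp add: baseline_decision_def)
  qed simp
  finally show ?thesis by simp
qed

lemma sum_rbl_weight_le_0:
  assumes c: "\<And>i. i \<in> {1..N} \<Longrightarrow> c i > 0"
    and W: "\<And>i. i \<in> {1..N} \<Longrightarrow> W i = c i * (L i - \<alpha>)"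
  shows "(\<Sum>i=1..N. rbl_decision N prio \<alpha> c L W V i * W i) \<le> 0"
proof -
  define xs where "xs = ranking N prio W V"
  define CT where "CT = total_capacity N \<alpha> c L"
  define k where "k = num_flips W CT xs"
  have CT: "0 \<le> CT" using total_capacity_nonneg c by (simp add: CT_def)
  have flips: "set (take k xs) \<subseteq> consideration_set N W V"
    using set_take_subset[of k xs] by (simp add: xs_def set_ranking)
  have "rbl_decision N prio \<alpha> c L W V i * W i =
      baseline_decision W V i * W i + (if i \<in> set (take k xs) then \<bar>W i\<bar> else 0)" for i
  proof (cases "i \<in> set (take k xs)")
    case True
    \<comment> \<open>A nonzero weight rules out the tie case of the baseline, whose decision is
      then 1 exactly when \<open>W i < 0\<close>. The flip drops a negative term or adds a positive
      one, a gain of \<open>\<bar>W i\<bar>\<close> either way.\<close>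
    then have "W i \<noteq> 0" using flips by (auto simp: consideration_set_def)
    then show ?thesis using True
      by (auto simp: rbl_decision_def Let_def baseline_decision_def k_def CT_def xs_def)
  qed (simp add: rbl_decision_def Let_def k_def CT_def xs_def)
  then have "(\<Sum>i=1..N. rbl_decision N prio \<alpha> c L W V i * W i) =
      - CT + (\<Sum>i=1..N. if i \<in> set (take k xs) then \<bar>W i\<bar> else 0)"
    using sum_baseline_weight[OF assms] by (simp add: sum.distrib CT_def)
  also have "(\<Sum>i=1..N. if i \<in> set (take k xs) then \<bar>W i\<bar> else 0) = (\<Sum>i\<in>set (take k xs). \<bar>W i\<bar>)"
    using flips by (subst sum.inter_restrict[symmetric])
      (auto simp: consideration_set_def intro!: sum.cong)
  also have "\<dots> = cum_weight W xs k"
    using num_flips_bounds(1)[OF CT]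
    by (simp add: cum_weight_eq_sum xs_def distinct_ranking k_def)
  also have "- CT + \<dots> \<le> 0" using num_flips_bounds(2)[OF CT] by (simp add: k_def)
  finally show ?thesis .
qed

subsection \<open>Measurability of the decisions\<close>

text \<open>The codomain is finite, so preimages of singletons suffice, and the event that the
  filtered set equals \<open>B\<close> is a finite intersection of events fixing the truth value of
  \<open>P j\<close>.\<close>

lemma measurable_finite_filter:
  assumes "finite A" and P: "\<And>j. j \<in> A \<Longrightarrow> Measurable.pred F (P j)"
  shows "(\<lambda>\<omega>. {j\<in>A. P j \<omega>}) \<in> F \<rightarrow>\<^sub>M count_space (Pow A)"
proof -
  have "(\<lambda>\<omega>. {j\<in>A. P j \<omega>}) -` {B} \<inter> space F \<in> sets F" if "B \<in> Pow A" for B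
  proof -
    have "(\<lambda>\<omega>. {j\<in>A. P j \<omega>}) -` {B} \<inter> space F = {\<omega>\<in>space F. \<forall>j\<in>A. P j \<omega> = (j \<in> B)}"
      using that by auto
    also have "\<dots> \<in> sets F"
    proof (intro sets.sets_Collect_finite_All \<open>finite A\<close>)
      fix j assume "j \<in> A"
      note [measurable] = P[OF this]
      show "{\<omega>\<in>space F. P j \<omega> = (j \<in> B)} \<in> sets F" by measurable
    qed
    finally show ?thesis .
  qed
  then show ?thesis using \<open>finite A\<close>
    by (auto simp: measurable_count_space_eq2)
qed

text \<open>Insertion stops at the head or recurses into the tail, according to a comparison of two
  measurable keys, which is an event.\<close>

lemma measurable_insort_key:
  fixes f :: "'w \<Rightarrow> 'i :: countable \<Rightarrow> 'k :: {second_countable_topology, linorder_topology}"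
  assumes "\<And>i. i \<in> insert x (set xs) \<Longrightarrow> (\<lambda>\<omega>. f \<omega> i) \<in> borel_measurable F"
  shows "(\<lambda>\<omega>. insort_key (f \<omega>) x xs) \<in> F \<rightarrow>\<^sub>M count_space UNIV"
  using assms
proof (induction xs)
  case (Cons y ys)
  have [measurable]: "(\<lambda>\<omega>. f \<omega> x) \<in> borel_measurable F" "(\<lambda>\<omega>. f \<omega> y) \<in> borel_measurable F"
    "(\<lambda>\<omega>. insort_key (f \<omega>) x ys) \<in> F \<rightarrow>\<^sub>M count_space UNIV"
    using Cons by auto
  show ?case by simp
qed simp

text \<open>The sorted tail that receives \<open>y\<close> is itself random, but it ranges over
  countably many lists, so it can be held fixed on each of countably many events.\<close>

lemma measurable_sort_key:
  fixes f :: "'w \<Rightarrow> 'i :: countable \<Rightarrow> 'k :: {second_countable_topology, linorder_topology}"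
  assumes "\<And>i. i \<in> set xs \<Longrightarrow> (\<lambda>\<omega>. f \<omega> i) \<in> borel_measurable F"
  shows "(\<lambda>\<omega>. sort_key (f \<omega>) xs) \<in> F \<rightarrow>\<^sub>M count_space UNIV"
  using assms
proof (induction xs)
  case (Cons y ys)
  \<comment> \<open>Every value of the sorted tail has the same entries as \<open>ys\<close>, so all
    keys met by the insertion are covered by the assumption on \<open>f\<close>.\<close>
  let ?I = "{zs. set zs = set ys}"
  have "(\<lambda>\<omega>. sort_key (f \<omega>) ys) \<in> F \<rightarrow>\<^sub>M count_space ?I"
    using Cons by (auto simp: measurable_count_space_eq2_countable)
  then have "(\<lambda>\<omega>. insort_key (f \<omega>) y (sort_key (f \<omega>) ys)) \<in> F \<rightarrow>\<^sub>M count_space UNIV"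
  proof (rule measurable_compose_countable'[rotated])
    show "(\<lambda>\<omega>. insort_key (f \<omega>) y zs) \<in> F \<rightarrow>\<^sub>M count_space UNIV" if "zs \<in> ?I" for zs
      using that Cons.prems by (intro measurable_insort_key) auto
  qed simp
  then show ?case by simp
qed simp

text \<open>The ranking forms the consideration set, sorts by priority, then sorts by ratio; the
  input of each sort takes countably many values and may be fixed. The codomain records that entries
  lie in \<open>{1..N}\<close>, where the keys are assumed measurable.\<close>

lemma measurable_ranking:
  assumes p: "\<And>i. i \<in> {1..N} \<Longrightarrow> (\<lambda>\<omega>. p \<omega> i) \<in> F \<rightarrow>\<^sub>M count_space UNIV"
    and W: "\<And>i. i \<in> {1..N} \<Longrightarrow> (\<lambda>\<omega>. W \<omega> i) \<in> borel_measurable F"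
    and V: "\<And>i. i \<in> {1..N} \<Longrightarrow> (\<lambda>\<omega>. V \<omega> i) \<in> borel_measurable F"
  shows "(\<lambda>\<omega>. ranking N (p \<omega>) (W \<omega>) (V \<omega>)) \<in> F \<rightarrow>\<^sub>M count_space {xs. set xs \<subseteq> {1..N}}"
proof -
  have pb: "(\<lambda>\<omega>. p \<omega> i) \<in> borel_measurable F" if "i \<in> {1..N}" for i
    using p[OF that] by (rule measurable_compose) simp
  have S: "(\<lambda>\<omega>. consideration_set N (W \<omega>) (V \<omega>)) \<in> F \<rightarrow>\<^sub>M count_space (Pow {1..N})"
    unfolding consideration_set_def
  proof (rule measurable_finite_filter)
    fix i assume i: "i \<in> {1..N}"
    note [measurable] = W[OF i] V[OF i]
    show "Measurable.pred F (\<lambda>\<omega>. 0 < W \<omega> i * V \<omega> i)" by measurable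
  qed simp
  have "(\<lambda>\<omega>. sort_key (p \<omega>) (sorted_list_of_set (consideration_set N (W \<omega>) (V \<omega>))))
      \<in> F \<rightarrow>\<^sub>M count_space UNIV"
  proof (rule measurable_compose_countable'[OF _ S])
    fix B assume "B \<in> Pow {1..N}"
    then show "(\<lambda>\<omega>. sort_key (p \<omega>) (sorted_list_of_set B)) \<in> F \<rightarrow>\<^sub>M count_space UNIV"
      using finite_subset[of B] pb by (intro measurable_sort_key) auto
  qed (simp add: countable_finite)
  then have "(\<lambda>\<omega>. sort_key (p \<omega>) (sorted_list_of_set (consideration_set N (W \<omega>) (V \<omega>))))
      \<in> F \<rightarrow>\<^sub>M count_space {xs. set xs \<subseteq> {1..N}}"
    by (auto simp: measurable_count_space_eq2_countable finite_consideration_set)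
       (auto simp: consideration_set_def)
  then have "(\<lambda>\<omega>. ranking N (p \<omega>) (W \<omega>) (V \<omega>)) \<in> F \<rightarrow>\<^sub>M count_space UNIV"
    unfolding ranking_def
  proof (rule measurable_compose_countable'[rotated])
    fix xs :: "nat list" assume xs: "xs \<in> {xs. set xs \<subseteq> {1..N}}"
    show "(\<lambda>\<omega>. sort_key (\<lambda>i. - (V \<omega> i / W \<omega> i)) xs) \<in> F \<rightarrow>\<^sub>M count_space UNIV"
    proof (rule measurable_sort_key)
      fix i assume "i \<in> set xs"
      then have i: "i \<in> {1..N}" using xs by auto
      note [measurable] = W[OF i] V[OF i]
      show "(\<lambda>\<omega>. - (V \<omega> i / W \<omega> i)) \<in> borel_measurable F" by measurable
    qed
  qed simp
  then show ?thesis
    by (auto simp: measurable_count_space_eq2_countable set_ranking)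
       (auto simp: consideration_set_def)
qed

text \<open>For a fixed list the feasible prefix lengths form a random subset of a finite set, and
  \<open>Max\<close> is measurable on a discrete space.\<close>

lemma measurable_num_flips:
  assumes W: "\<And>i. i \<in> set xs \<Longrightarrow> (\<lambda>\<omega>. W \<omega> i) \<in> borel_measurable F"
    and C: "C \<in> borel_measurable F"
  shows "(\<lambda>\<omega>. num_flips (W \<omega>) (C \<omega>) xs) \<in> F \<rightarrow>\<^sub>M count_space UNIV"
proof -
  have "(\<lambda>\<omega>. {j\<in>{..length xs}. cum_weight (W \<omega>) xs j \<le> C \<omega>})
      \<in> F \<rightarrow>\<^sub>M count_space (Pow {..length xs})"
  proof (rule measurable_finite_filter)
    fix j assume j: "j \<in> {..length xs}"
    have [measurable]: "(\<lambda>\<omega>. cum_weight (W \<omega>) xs j) \<in> borel_measurable F"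
      unfolding cum_weight_def
    proof (rule borel_measurable_sum)
      fix r assume "r \<in> {..<j}"
      then have "xs ! r \<in> set xs" using j by simp
      from W[OF this] show "(\<lambda>\<omega>. \<bar>W \<omega> (xs ! r)\<bar>) \<in> borel_measurable F"
        by (rule borel_measurable_abs)
    qed
    note [measurable] = C
    show "Measurable.pred F (\<lambda>\<omega>. cum_weight (W \<omega>) xs j \<le> C \<omega>)" by measurable
  qed simp
  from measurable_compose[OF this measurable_count_space, of Max]
  show ?thesis by (simp only: num_flips_def atMost_iff)
qed

lemma measurable_rbl_decision:
  assumes p: "\<And>i. i \<in> {1..N} \<Longrightarrow> (\<lambda>\<omega>. p \<omega> i) \<in> F \<rightarrow>\<^sub>M count_space UNIV"
    and L: "\<And>i. i \<in> {1..N} \<Longrightarrow> (\<lambda>\<omega>. L \<omega> i) \<in> borel_measurable F"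
    and W: "\<And>i. i \<in> {1..N} \<Longrightarrow> (\<lambda>\<omega>. W \<omega> i) \<in> borel_measurable F"
    and V: "\<And>i. i \<in> {1..N} \<Longrightarrow> (\<lambda>\<omega>. V \<omega> i) \<in> borel_measurable F"
    and i: "i \<in> {1..N}"
  shows "(\<lambda>\<omega>. rbl_decision N (p \<omega>) \<alpha> c (L \<omega>) (W \<omega>) (V \<omega>) i) \<in> borel_measurable F"
proof -
  let ?C = "\<lambda>\<omega>. total_capacity N \<alpha> c (L \<omega>)"
  have C: "?C \<in> borel_measurable F"
  proof -
    \<comment> \<open>The index set of the capacity depends on the outcome; conditional terms over
      the fixed range \<open>{1..N}\<close> remove that dependence.\<close>
    have "(\<lambda>\<omega>. \<Sum>i=1..N. if L \<omega> i < \<alpha> then c i * (\<alpha> - L \<omega> i) else 0) \<in> borel_measurable F"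
    proof (rule borel_measurable_sum)
      fix j assume "j \<in> {1..N}"
      note [measurable] = L[OF this]
      show "(\<lambda>\<omega>. if L \<omega> j < \<alpha> then c j * (\<alpha> - L \<omega> j) else 0) \<in> borel_measurable F"
        by measurable
    qed
    then show ?thesis unfolding total_capacity_def by (simp only: sum.inter_filter finite_atLeastAtMost)
  qed
  let ?R = "\<lambda>\<omega>. ranking N (p \<omega>) (W \<omega>) (V \<omega>)"
  have "Measurable.pred F (\<lambda>\<omega>. i \<in> set (take (num_flips (W \<omega>) (?C \<omega>) (?R \<omega>)) (?R \<omega>)))"
  \<comment> \<open>Both the number of flips and the prefix depend on the ranking, which takes
    countably many values and may be fixed to \<open>xs\<close>.\<close>
  proof (rule measurable_compose_countable'[OF _ measurable_ranking[OF p W V]])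
    fix xs :: "nat list" assume "xs \<in> {xs. set xs \<subseteq> {1..N}}"
    then have "(\<lambda>\<omega>. num_flips (W \<omega>) (?C \<omega>) xs) \<in> F \<rightarrow>\<^sub>M count_space UNIV"
      by (intro measurable_num_flips[OF W C]) auto
    then show "Measurable.pred F (\<lambda>\<omega>. i \<in> set (take (num_flips (W \<omega>) (?C \<omega>) xs) xs))"
      by (rule measurable_compose[where g = "\<lambda>k. i \<in> set (take k xs)"]) simp
  qed auto
  note [measurable] = this W[OF i] V[OF i]
  show ?thesis unfolding rbl_decision_def Let_def baseline_decision_def by measurable
qed

subsection \<open>Averaging over the data\<close>

text \<open>The normalised weights \<open>h i / s\<close> are \<open>F\<close>-measurable and lie in
  [0,1], so they pass through the conditional expectation, which turns indicators into conditional
  probabilities. The resulting integrand is at most \<alpha> almost everywhere by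
  \<open>le\<close>.\<close>

lemma (in sigma_finite_subalgebra) weighted_ratio_expectation_le:
  fixes A :: "'i \<Rightarrow> 'a set" and h :: "'i \<Rightarrow> 'a \<Rightarrow> real"
  assumes "prob_space M" "finite I"
    and A: "\<And>i. i \<in> I \<Longrightarrow> A i \<in> sets M"
    and h: "\<And>i. i \<in> I \<Longrightarrow> h i \<in> borel_measurable F"
    and h0: "\<And>i \<omega>. i \<in> I \<Longrightarrow> 0 \<le> h i \<omega>"
    and "0 \<le> \<alpha>"
    and le: "AE \<omega> in M. (\<Sum>i\<in>I. h i \<omega> * real_cond_exp M F (indicator (A i)) \<omega>) \<le> \<alpha> * (\<Sum>i\<in>I. h i \<omega>)"
  shows "(\<integral>\<omega>. (\<Sum>i\<in>I. indicator (A i) \<omega> * h i \<omega>) / (\<Sum>i\<in>I. h i \<omega>) \<partial>M) \<le> \<alpha>"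
proof -
  interpret prob_space M by fact
  define s where "s \<omega> = (\<Sum>i\<in>I. h i \<omega>)" for \<omega>
  define q where "q i \<omega> = h i \<omega> / s \<omega>" for i \<omega>
  have s0: "0 \<le> s \<omega>" for \<omega> unfolding s_def by (intro sum_nonneg h0)
  have q01: "0 \<le> q i \<omega> \<and> q i \<omega> \<le> 1" if "i \<in> I" for i \<omega>
  proof -
    have "h i \<omega> \<le> s \<omega>" unfolding s_def by (intro member_le_sum h0 that \<open>finite I\<close>) auto
    then show ?thesis using h0[OF that] s0[of \<omega>]
      by (auto simp: q_def divide_le_eq)
  qed
  have qF: "q i \<in> borel_measurable F" if "i \<in> I" for i
    unfolding q_def s_def using h that by (intro borel_measurable_divide borel_measurable_sum) auto
  have int: "integrable M (\<lambda>\<omega>. q i \<omega> * indicator (A i) \<omega>)" if "i \<in> I" for i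
  proof (rule integrable_const_bound[of _ 1])
    show "AE \<omega> in M. norm (q i \<omega> * indicator (A i) \<omega>) \<le> 1"
      using q01[OF that] by (auto simp: indicator_def)
    show "(\<lambda>\<omega>. q i \<omega> * indicator (A i) \<omega>) \<in> borel_measurable M"
      using measurable_from_subalg[OF subalg qF[OF that]] A[OF that] by measurable
  qed
  note ce = real_cond_exp_intg[OF int qF borel_measurable_indicator[OF A]]
  have "(\<integral>\<omega>. (\<Sum>i\<in>I. indicator (A i) \<omega> * h i \<omega>) / (\<Sum>i\<in>I. h i \<omega>) \<partial>M) =
      (\<integral>\<omega>. (\<Sum>i\<in>I. q i \<omega> * indicator (A i) \<omega>) \<partial>M)"
    by (simp add: q_def s_def sum_divide_distrib mult.commute)
  also have "\<dots> = (\<Sum>i\<in>I. \<integral>\<omega>. q i \<omega> * indicator (A i) \<omega> \<partial>M)"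
    by (rule Bochner_Integration.integral_sum) (rule int)
  also have "\<dots> = (\<Sum>i\<in>I. \<integral>\<omega>. q i \<omega> * real_cond_exp M F (indicator (A i)) \<omega> \<partial>M)"
    by (intro sum.cong refl ce(2)[symmetric])
  also have "\<dots> = (\<integral>\<omega>. (\<Sum>i\<in>I. q i \<omega> * real_cond_exp M F (indicator (A i)) \<omega>) \<partial>M)"
    by (rule Bochner_Integration.integral_sum[symmetric]) (rule ce(1))
  also have "\<dots> \<le> (\<integral>\<omega>. \<alpha> \<partial>M)"
  proof (rule integral_mono_AE)
    show "AE \<omega> in M. (\<Sum>i\<in>I. q i \<omega> * real_cond_exp M F (indicator (A i)) \<omega>) \<le> \<alpha>"
      using le
    proof eventually_elim
      case (elim \<omega>)
      have "(\<Sum>i\<in>I. q i \<omega> * real_cond_exp M F (indicator (A i)) \<omega>) =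
          (\<Sum>i\<in>I. h i \<omega> * real_cond_exp M F (indicator (A i)) \<omega>) / s \<omega>"
        by (simp add: q_def sum_divide_distrib)
      \<comment> \<open>Where \<open>s\<close> vanishes, division by zero returns 0 and
        \<open>0 \<le> \<alpha>\<close> gives the bound; elsewhere \<open>elim\<close> is divided by
        \<open>s\<close>.\<close>
      also have "\<dots> \<le> \<alpha>"
        using elim s0[of \<omega>] \<open>0 \<le> \<alpha>\<close> by (cases "s \<omega> = 0") (auto simp: divide_le_eq s_def)
      finally show ?case .
    qed
  qed (auto intro: ce(1))
  also have "\<dots> = \<alpha>" by (simp add: prob_space)
  finally show ?thesis .
qed

text \<open>Linearity, with the constant \<alpha> as its own conditional expectation. This links the
  weight to the local false discovery rate.\<close>

lemma (in sigma_finite_subalgebra) real_cond_exp_affine_indicator: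
  assumes "prob_space M" "A \<in> sets M"
  shows "AE \<omega> in M. real_cond_exp M F (\<lambda>\<omega>. c * (indicator A \<omega> - \<alpha>)) \<omega> =
    c * (real_cond_exp M F (indicator A) \<omega> - \<alpha>)"
proof -
  interpret prob_space M by fact
  have i: "integrable M (indicator A :: 'a \<Rightarrow> real)" "integrable M (\<lambda>_. \<alpha>)"
    using assms(2) by (simp_all add: integrable_indicator_iff emeasure_eq_measure)
  show ?thesis
    using real_cond_exp_cmult[OF Bochner_Integration.integrable_diff[OF i], of c]
      real_cond_exp_diff[OF i] real_cond_exp_F_meas[OF i(2) borel_measurable_const]
    by eventually_elim simp
qed

theorem proposition1:
  fixes M :: "'a measure" and D :: "'d measure" and X :: "'a \<Rightarrow> 'd"
    and N :: nat and \<alpha> :: real and c profit :: "nat \<Rightarrow> real"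
    and p0 p1 :: "nat \<Rightarrow> 'a \<Rightarrow> real"
    and prio :: "'d \<Rightarrow> nat \<Rightarrow> nat"
    and \<delta> :: "nat \<Rightarrow> 'a \<Rightarrow> real"
  assumes "prob_space M"
    and "X \<in> M \<rightarrow>\<^sub>M D"
    and "0 < \<alpha>" and "\<alpha> < 1"
    and "\<And>i. i \<in> {1..N} \<Longrightarrow> c i > 0"
    and "\<And>i. i \<in> {1..N} \<Longrightarrow> profit i > 0"
    and "\<And>i. i \<in> {1..N} \<Longrightarrow> p0 i \<in> borel_measurable M"
    and "\<And>i. i \<in> {1..N} \<Longrightarrow> p1 i \<in> borel_measurable M"
    and "\<And>i. i \<in> {1..N} \<Longrightarrow> AE \<omega> in M. 0 < p0 i \<omega> \<and> p0 i \<omega> \<le> 1"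
    and "\<And>i. i \<in> {1..N} \<Longrightarrow> AE \<omega> in M. 0 \<le> p1 i \<omega> \<and> p1 i \<omega> \<le> 1"
    and "\<And>i. i \<in> {1..N} \<Longrightarrow> post_value_finite M D X (profit i) (p0 i) (p1 i)"
    and "\<And>i. i \<in> {1..N} \<Longrightarrow> (\<lambda>x. prio x i) \<in> D \<rightarrow>\<^sub>M count_space UNIV"
    and "\<And>i \<omega>. \<delta> i \<omega> = oracle_rbl M D X N prio \<alpha> c profit p0 p1 i \<omega>"
  shows "prob_space.expectation M
           (\<lambda>\<omega>. (\<Sum>i=1..N. (1 - theta (p0 i) (p1 i) \<omega>) * \<delta> i \<omega> * c i)
                / (\<Sum>i=1..N. \<delta> i \<omega> * c i)) \<le> \<alpha>"
proof -
  interpret prob_space M by fact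
  define F where "F = data_algebra M D X"
  have X: "X \<in> F \<rightarrow>\<^sub>M D"
    unfolding F_def using assms(2) by (intro measurable_vimage_algebra1) (auto dest: measurable_space)
  have "subalgebra M F"
    unfolding subalgebra_def F_def
    using assms(2) by (auto simp: sets_vimage_algebra2 measurable_space dest: measurable_sets)
  then interpret finite_measure_subalgebra M F by unfold_locales
  \<comment> \<open>\<open>lfdr\<close> conditions the indicator of a subset of the whole type;
    cutting it down to \<open>space M\<close> gives an event, and the two indicators agree on
    \<open>space M\<close>.\<close>
  define A where "A i = {\<omega>\<in>space M. theta (p0 i) (p1 i) \<omega> = 0}" for i
  define L where "L i = lfdr M D X (p0 i) (p1 i)" for i
  define W where "W i = weight M D X \<alpha> (c i) (p0 i) (p1 i)" for i
  define V where "V i = post_value M D X (profit i) (p0 i) (p1 i)" for i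
  have \<delta>: "\<delta> i \<omega> = rbl_decision N (prio (X \<omega>)) \<alpha> c (\<lambda>j. L j \<omega>) (\<lambda>j. W j \<omega>) (\<lambda>j. V j \<omega>) i" for i \<omega>
    by (simp add: assms(13) oracle_rbl_def L_def W_def V_def)
  have A: "A i \<in> sets M" if i: "i \<in> {1..N}" for i
  proof -
    note [measurable] = assms(7,8)[OF i]
    show ?thesis unfolding A_def theta_def lift_def by measurable
  qed
  have ind: "1 - theta (p0 i) (p1 i) \<omega> = indicator (A i) \<omega>" if "\<omega> \<in> space M" for i \<omega>
    using that by (auto simp: A_def theta_def indicator_def)
  have theta_meas: "theta (p0 i) (p1 i) \<in> borel_measurable M" if i: "i \<in> {1..N}" for i
  proof -
    note [measurable] = assms(7,8)[OF i]
    show ?thesis unfolding theta_def[abs_def] lift_def by measurable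
  qed
  have 1: "AE \<omega> in M. L i \<omega> = real_cond_exp M F (indicator (A i)) \<omega>" if "i \<in> {1..N}" for i
    unfolding L_def lfdr_def F_def[symmetric]
    using A[OF that] by (intro real_cond_exp_cong)
      (auto simp: A_def indicator_def cong: measurable_cong)
  \<comment> \<open>\<open>W i\<close> is defined by a conditional expectation of its own, so its
    relation to \<open>L i\<close> is obtained only almost everywhere.\<close>
  have 2: "AE \<omega> in M. W i \<omega> = c i * (L i \<omega> - \<alpha>)" if i: "i \<in> {1..N}" for i
  proof -
    have "AE \<omega> in M. W i \<omega> = real_cond_exp M F (\<lambda>\<omega>. c i * (indicator (A i) \<omega> - \<alpha>)) \<omega>"
      unfolding W_def weight_def F_def[symmetric] using A[OF i] theta_meas[OF i]
      by (intro real_cond_exp_cong) (auto simp: ind)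
    with 1[OF i] real_cond_exp_affine_indicator[OF assms(1) A[OF i], of "c i" \<alpha>]
    show ?thesis by eventually_elim simp
  qed
  have \<delta>F: "\<delta> i \<in> borel_measurable F" if "i \<in> {1..N}" for i
  proof -
    have "(\<lambda>\<omega>. prio (X \<omega>) j) \<in> F \<rightarrow>\<^sub>M count_space UNIV" if "j \<in> {1..N}" for j
      using X assms(12)[OF that] by (rule measurable_compose)
    then have "(\<lambda>\<omega>. \<delta> i \<omega>) \<in> borel_measurable F"
      unfolding \<delta> using that by (intro measurable_rbl_decision)
        (auto simp: L_def W_def V_def lfdr_def weight_def post_value_def F_def)
    then show ?thesis by simp
  qed
  have \<delta>0: "0 \<le> \<delta> i \<omega>" for i \<omega>
    using rbl_decision_01[of N "prio (X \<omega>)" \<alpha> c] unfolding \<delta>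
    by (metis insert_iff empty_iff zero_le_one order_refl)
  \<comment> \<open>There are finitely many experiments, so their exceptional null sets combine into
    one.\<close>
  have "AE \<omega> in M. \<forall>i\<in>{1..N}.
      L i \<omega> = real_cond_exp M F (indicator (A i)) \<omega> \<and> W i \<omega> = c i * (L i \<omega> - \<alpha>)"
    using 1 2 by (intro AE_finite_allI) auto
  then have "AE \<omega> in M. (\<Sum>i=1..N. \<delta> i \<omega> * c i * real_cond_exp M F (indicator (A i)) \<omega>)
      \<le> \<alpha> * (\<Sum>i=1..N. \<delta> i \<omega> * c i)"
  proof eventually_elim
    case (elim \<omega>)
    \<comment> \<open>The excess over \<alpha> weighs each rejection by its cost times the
      conditional probability minus \<alpha>, which is \<open>W i\<close>; this brings in the
      capacity bound.\<close>
    have "(\<Sum>i=1..N. \<delta> i \<omega> * c i * real_cond_exp M F (indicator (A i)) \<omega>) - \<alpha> * (\<Sum>i=1..N. \<delta> i \<omega> * c i) =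
        (\<Sum>i=1..N. \<delta> i \<omega> * W i \<omega>)"
      unfolding sum_distrib_left sum_subtractf[symmetric]
    proof (rule sum.cong)
      fix i assume "i \<in> {1..N}"
      with elim have "W i \<omega> = c i * (real_cond_exp M F (indicator (A i)) \<omega> - \<alpha>)" by simp
      then show "\<delta> i \<omega> * c i * real_cond_exp M F (indicator (A i)) \<omega> - \<alpha> * (\<delta> i \<omega> * c i) =
          \<delta> i \<omega> * W i \<omega>"
        by (simp only: right_diff_distrib mult_ac)
    qed simp
    also have "\<dots> \<le> 0"
      unfolding \<delta> using elim assms(5) by (intro sum_rbl_weight_le_0) auto
    finally show ?case by simp
  qed
  \<comment> \<open>The rejection costs \<open>\<delta> i \<omega> * c i\<close> take the place of
    \<open>h i\<close>: they are nonnegative and determined by the data.\<close>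
  then have "(\<integral>\<omega>. (\<Sum>i=1..N. indicator (A i) \<omega> * (\<delta> i \<omega> * c i)) / (\<Sum>i=1..N. \<delta> i \<omega> * c i) \<partial>M) \<le> \<alpha>"
  proof (rule weighted_ratio_expectation_le[OF \<open>prob_space M\<close>, rotated -1])
    fix i assume i: "i \<in> {1..N}"
    show "A i \<in> sets M" by (rule A[OF i])
    show "(\<lambda>\<omega>. \<delta> i \<omega> * c i) \<in> borel_measurable F"
      by (intro borel_measurable_times \<delta>F[OF i] borel_measurable_const)
    show "0 \<le> \<delta> i \<omega> * c i" for \<omega>
      using \<delta>0 assms(5)[OF i] by (simp add: less_imp_le)
  qed (use assms(3) in simp_all)
  also have "(\<integral>\<omega>. (\<Sum>i=1..N. indicator (A i) \<omega> * (\<delta> i \<omega> * c i)) / (\<Sum>i=1..N. \<delta> i \<omega> * c i) \<partial>M) =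
      (\<integral>\<omega>. (\<Sum>i=1..N. (1 - theta (p0 i) (p1 i) \<omega>) * \<delta> i \<omega> * c i) / (\<Sum>i=1..N. \<delta> i \<omega> * c i) \<partial>M)"
    by (intro Bochner_Integration.integral_cong) (auto simp: ind mult.assoc)
  finally show ?thesis .
qed

end
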